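(* Let $G$ be an infinite, connected, vertex-transitive, $d$-regular directed graph (with symmetric edge set) and assume $d\ge3$. (i) If $p_0+p_1$ is sufficiently near to $1$, then $\theta(G,{\bf p})=0$; that is, there is $\epsilon>0$ such that $\theta(G,{\bf p})=0$ for every ${\bf p}$ with $p_0+p_1>1-\epsilon$. (ii) Let $k$ be an integer with $0\le k\le d$ and $k(k-1)<d$. If $p_0+p_1+\cdots+p_k$ is sufficiently near to $1$, then $\tilde\theta(G,{\bf p})=0$; that is, there is $\epsilon>0$ such that $\tilde\theta(G,{\bf p})=0$ for every ${\bf p}$ with $p_0+\cdots+p_k>1-\epsilon$.
   Context: $G=(V,E,o)$ is an infinite simple directed graph with origin $o\in V$: $V$ is countably infinite, $E\subset V\times V\setminus\{(x,x)\}$, and $(x,y)\in E$ iff $(y,x)\in E$; write $x\sim y$ if $(x,y)\in E$ and $L_x=\{y:(x,y)\in E\}$. $G$ is $d$-regular ($|L_x|=d$ for all $x$), connected (any two vertices are joined by a finite chain of $\sim$), and vertex-transitive (for all $x,y\in V$ some bijection $f:V\to V$ preserving $E$ in both directions has $f(x)=y$). Let ${\bf p}=(p_0,\dots,p_d)$ with $p_i\ge0$ and $\sum_i p_i=1$. Configurations are $\omega\in\Omega=\prod_{x\in V}2^{L_x}$ with the $\sigma$-field generated by finite-dimensional cylinders; $P_{\bf p}$ is the product measure under which the states $\omega(x)\subset L_x$ are independent with $P_{\bf p}(\omega(x)=S)=p_{|S|}/\binom{d}{|S|}$ for $S\subset L_x$. Put $E_\omega=\{(x,y):x\in V,\ y\in\omega(x)\}$.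 Vertices $x,y$ are weakly connected if $x=y$ or there are $x=z_0,\dots,z_m=y$ such that for each $i$, $(z_i,z_{i+1})\in E_\omega$ or $(z_{i+1},z_i)\in E_\omega$; strongly connected if $x=y$ or there is such a sequence with both $(z_i,z_{i+1})\in E_\omega$ and $(z_{i+1},z_i)\in E_\omega$ for each $i$. $|C|$ (resp. $|\tilde C|$) is the number of vertices weakly (resp. strongly) connected to $o$; $\theta(G,{\bf p})=P_{\bf p}(|C|=\infty)$ and $\tilde\theta(G,{\bf p})=P_{\bf p}(|\tilde C|=\infty)$. *)

theory Defs
  imports "HOL-Probability.Probability"
begin

definition infinite_simple_digraph :: "'v set \<Rightarrow> ('v \<times> 'v) set \<Rightarrow> 'v \<Rightarrow> bool" where
  "infinite_simple_digraph V E orig \<longleftrightarrow>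
     infinite V \<and> countable V \<and> E \<subseteq> V \<times> V \<and> irrefl E \<and> sym E \<and> orig \<in> V"

definition nbrs :: "('v \<times> 'v) set \<Rightarrow> 'v \<Rightarrow> 'v set" where
  "nbrs E x = {y. (x, y) \<in> E}"

definition regular_graph :: "'v set \<Rightarrow> ('v \<times> 'v) set \<Rightarrow> nat \<Rightarrow> bool" where
  "regular_graph V E d \<longleftrightarrow> (\<forall>x\<in>V. finite (nbrs E x) \<and> card (nbrs E x) = d)"

definition connected_graph :: "'v set \<Rightarrow> ('v \<times> 'v) set \<Rightarrow> bool" where
  "connected_graph V E \<longleftrightarrow> (\<forall>x\<in>V. \<forall>y\<in>V. (x, y) \<in> E\<^sup>*)"

definition vertex_transitive_graph :: "'v set \<Rightarrow> ('v \<times> 'v) set \<Rightarrow> bool" where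
  "vertex_transitive_graph V E \<longleftrightarrow>
     (\<forall>x\<in>V. \<forall>y\<in>V. \<exists>f. bij_betw f V V \<and>
        (\<forall>u\<in>V. \<forall>v\<in>V. (u, v) \<in> E \<longleftrightarrow> (f u, f v) \<in> E) \<and> f x = y)"

text \<open>A probability vector \<open>(p\<^sub>0, \<dots>, p\<^sub>d)\<close> is a function on the naturals of which
  only the values at \<open>0, \<dots>, d\<close> are ever used.\<close>

definition prob_vector :: "nat \<Rightarrow> (nat \<Rightarrow> real) \<Rightarrow> bool" where
  "prob_vector d p \<longleftrightarrow> (\<forall>i\<le>d. 0 \<le> p i) \<and> (\<Sum>i\<le>d. p i) = 1"

definition vertex_measure :: "('v \<times> 'v) set \<Rightarrow> nat \<Rightarrow> (nat \<Rightarrow> real) \<Rightarrow> 'v \<Rightarrow> 'v set measure" where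
  "vertex_measure E d p x =
     point_measure (Pow (nbrs E x)) (\<lambda>S. ennreal (p (card S) / real (d choose card S)))"

definition config_measure ::
    "'v set \<Rightarrow> ('v \<times> 'v) set \<Rightarrow> nat \<Rightarrow> (nat \<Rightarrow> real) \<Rightarrow> ('v \<Rightarrow> 'v set) measure" where
  "config_measure V E d p = (\<Pi>\<^sub>M x\<in>V. vertex_measure E d p x)"

definition config_arcs :: "'v set \<Rightarrow> ('v \<Rightarrow> 'v set) \<Rightarrow> ('v \<times> 'v) set" where
  "config_arcs V \<omega> = {(x, y). x \<in> V \<and> y \<in> \<omega> x}"

definition weakly_connected :: "'v set \<Rightarrow> ('v \<Rightarrow> 'v set) \<Rightarrow> ('v \<times> 'v) set" where
  "weakly_connected V \<omega> = (config_arcs V \<omega> \<union> (config_arcs V \<omega>)\<inverse>)\<^sup>*"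

text \<open>Every single step of a strong connection has to be open in both directions; this is
  not the usual notion of strong connectedness of a digraph.\<close>

definition strongly_connected :: "'v set \<Rightarrow> ('v \<Rightarrow> 'v set) \<Rightarrow> ('v \<times> 'v) set" where
  "strongly_connected V \<omega> = (config_arcs V \<omega> \<inter> (config_arcs V \<omega>)\<inverse>)\<^sup>*"

definition weak_cluster :: "'v set \<Rightarrow> 'v \<Rightarrow> ('v \<Rightarrow> 'v set) \<Rightarrow> 'v set" where
  "weak_cluster V orig \<omega> = {x \<in> V. (orig, x) \<in> weakly_connected V \<omega>}"

definition strong_cluster :: "'v set \<Rightarrow> 'v \<Rightarrow> ('v \<Rightarrow> 'v set) \<Rightarrow> 'v set" where
  "strong_cluster V orig \<omega> = {x \<in> V. (orig, x) \<in> strongly_connected V \<omega>}"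

definition weak_theta ::
    "'v set \<Rightarrow> ('v \<times> 'v) set \<Rightarrow> 'v \<Rightarrow> nat \<Rightarrow> (nat \<Rightarrow> real) \<Rightarrow> real" where
  "weak_theta V E orig d p =
     measure (config_measure V E d p)
       {\<omega> \<in> space (config_measure V E d p). infinite (weak_cluster V orig \<omega>)}"

definition strong_theta ::
    "'v set \<Rightarrow> ('v \<times> 'v) set \<Rightarrow> 'v \<Rightarrow> nat \<Rightarrow> (nat \<Rightarrow> real) \<Rightarrow> real" where
  "strong_theta V E orig d p =
     measure (config_measure V E d p)
       {\<omega> \<in> space (config_measure V E d p). infinite (strong_cluster V orig \<omega>)}"

text \<open>Since \<open>measure\<close> is 0 on non-measurable sets and \<open>\<Pi>\<^sub>M\<close> is only
  meaningful for probability spaces, we check that the marginals are probability spaces and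
  that both percolation events are measurable.\<close>

lemma prob_space_vertex_measure:
  assumes "finite (nbrs E x)" "card (nbrs E x) = d" "prob_vector d p"
  shows "prob_space (vertex_measure E d p x)"
proof
  let ?L = "nbrs E x"
  let ?f = "\<lambda>S :: 'a set. p (card S) / real (d choose card S)"
  have le: "card S \<le> d" if "S \<in> Pow ?L" for S
    using that assms card_mono[of ?L S] by auto
  have nn: "0 \<le> ?f S" if "S \<in> Pow ?L" for S
    using le[OF that] assms(3) by (auto simp: prob_vector_def)
  have *: "{S \<in> Pow ?L. card S = i} = {S. S \<subseteq> ?L \<and> card S = i}" for i by auto
  have "(\<Sum>S\<in>Pow ?L. ?f S) = (\<Sum>i\<le>d. \<Sum>S\<in>{S \<in> Pow ?L. card S = i}. ?f S)"
    by (rule sum.group[symmetric]) (use assms le in auto)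
  also have "\<dots> = (\<Sum>i\<le>d. \<Sum>S\<in>{S \<in> Pow ?L. card S = i}. p i / real (d choose i))"
    by (intro sum.cong refl) auto
  also have "\<dots> = (\<Sum>i\<le>d. p i)"
    by (intro sum.cong refl) (simp add: * n_subsets[OF assms(1)] assms(2))
  also have "\<dots> = 1" using assms(3) by (simp add: prob_vector_def)
  finally have "(\<Sum>S\<in>Pow ?L. ?f S) = 1" .
  moreover have "(\<Sum>S\<in>Pow ?L. ennreal (?f S)) = ennreal (\<Sum>S\<in>Pow ?L. ?f S)"
    by (rule sum_ennreal) (rule nn)
  ultimately have "(\<Sum>S\<in>Pow ?L. ennreal (?f S)) = 1" by simp
  then show "emeasure (vertex_measure E d p x) (space (vertex_measure E d p x)) = 1"
    using assms(1)
    by (simp add: vertex_measure_def space_point_measure emeasure_point_measure_finite)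
qed

lemma prob_space_config_measure:
  assumes "regular_graph V E d" "prob_vector d p"
  shows "prob_space (config_measure V E d p)"
  unfolding config_measure_def
  by (rule prob_space_PiM) (use assms in \<open>auto simp: regular_graph_def intro: prob_space_vertex_measure\<close>)

lemma config_arc_measurable:
  "{\<omega> \<in> space (config_measure V E d p). (x, y) \<in> config_arcs V \<omega>} \<in> sets (config_measure V E d p)"
proof (cases "x \<in> V")
  case True
  have "(\<lambda>\<omega>. \<omega> x) -` {S \<in> Pow (nbrs E x). y \<in> S} \<inter> space (config_measure V E d p)
      \<in> sets (config_measure V E d p)"
    unfolding config_measure_def
    by (rule measurable_sets[OF measurable_component_singleton[OF True]])
      (auto simp: vertex_measure_def sets_point_measure)
  also have "(\<lambda>\<omega>. \<omega> x) -` {S \<in> Pow (nbrs E x). y \<in> S} \<inter> space (config_measure V E d p)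
      = {\<omega> \<in> space (config_measure V E d p). (x, y) \<in> config_arcs V \<omega>}"
    using True
    by (auto simp: config_arcs_def config_measure_def space_PiM vertex_measure_def
        space_point_measure dest: PiE_mem)
  finally show ?thesis .
qed (simp add: config_arcs_def)

lemma infinite_rtrancl_measurable:
  assumes V: "countable V"
    and R: "\<And>x y. x \<in> V \<Longrightarrow> y \<in> V \<Longrightarrow> {\<omega> \<in> space M. (x, y) \<in> R \<omega>} \<in> sets M"
    and sub: "\<And>\<omega>. \<omega> \<in> space M \<Longrightarrow> R \<omega> \<subseteq> V \<times> V" and "orig \<in> V"
  shows "{\<omega> \<in> space M. infinite {x \<in> V. (orig, x) \<in> (R \<omega>)\<^sup>*}} \<in> sets M"
proof -
  have n: "{\<omega> \<in> space M. (x, y) \<in> R \<omega> ^^ n} \<in> sets M" if "x \<in> V" "y \<in> V" for x y n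
    using that
  proof (induction n arbitrary: y)
    case (Suc n)
    have "{\<omega> \<in> space M. (x, y) \<in> R \<omega> ^^ Suc n} =
        (\<Union>z\<in>V. {\<omega> \<in> space M. (x, z) \<in> R \<omega> ^^ n} \<inter> {\<omega> \<in> space M. (z, y) \<in> R \<omega>})"
      using sub by fastforce
    moreover have "\<dots> \<in> sets M"
      using Suc V R by (intro sets.countable_UN'' sets.Int) auto
    ultimately show ?case by simp
  qed simp
  have star: "{\<omega> \<in> space M. (orig, x) \<in> (R \<omega>)\<^sup>*} \<in> sets M" if "x \<in> V" for x
  proof -
    have "{\<omega> \<in> space M. (orig, x) \<in> (R \<omega>)\<^sup>*} = (\<Union>n. {\<omega> \<in> space M. (orig, x) \<in> R \<omega> ^^ n})"
      by (auto simp: rtrancl_power)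
    then show ?thesis using n[OF \<open>orig \<in> V\<close> that] by auto
  qed
  have "{\<omega> \<in> space M. infinite {x \<in> V. (orig, x) \<in> (R \<omega>)\<^sup>*}} =
      (\<Inter>F\<in>{F. finite F \<and> F \<subseteq> V}. \<Union>x\<in>V - F. {\<omega> \<in> space M. (orig, x) \<in> (R \<omega>)\<^sup>*})"
  proof (intro set_eqI iffI)
    fix \<omega> assume a: "\<omega> \<in> {\<omega> \<in> space M. infinite {x \<in> V. (orig, x) \<in> (R \<omega>)\<^sup>*}}"
    have "\<exists>x\<in>V - F. (orig, x) \<in> (R \<omega>)\<^sup>*" if "finite F" for F
      using a finite_subset[OF _ that, of "{x \<in> V. (orig, x) \<in> (R \<omega>)\<^sup>*}"] by auto
    with a show "\<omega> \<in> (\<Inter>F\<in>{F. finite F \<and> F \<subseteq> V}. \<Union>x\<in>V - F.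
        {\<omega> \<in> space M. (orig, x) \<in> (R \<omega>)\<^sup>*})" by auto
  next
    fix \<omega> assume a: "\<omega> \<in> (\<Inter>F\<in>{F. finite F \<and> F \<subseteq> V}. \<Union>x\<in>V - F.
        {\<omega> \<in> space M. (orig, x) \<in> (R \<omega>)\<^sup>*})"
    then have "\<omega> \<in> space M" by (auto dest!: bspec[of _ _ "{}"])
    moreover have "infinite {x \<in> V. (orig, x) \<in> (R \<omega>)\<^sup>*}"
      using a by (auto dest!: bspec[of _ _ "{x \<in> V. (orig, x) \<in> (R \<omega>)\<^sup>*}"])
    ultimately show "\<omega> \<in> {\<omega> \<in> space M. infinite {x \<in> V. (orig, x) \<in> (R \<omega>)\<^sup>*}}" by simp
  qed
  moreover have "\<dots> \<in> sets M"
  proof (rule sets.countable_INT')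
    show "countable {F. finite F \<and> F \<subseteq> V}" using V by (rule countable_Collect_finite_subset)
    show "{F. finite F \<and> F \<subseteq> V} \<noteq> {}" by blast
    have "(\<Union>x\<in>V - F. {\<omega> \<in> space M. (orig, x) \<in> (R \<omega>)\<^sup>*}) \<in> sets M" for F
      by (rule sets.countable_UN'') (use V star in auto)
    then show "(\<lambda>F. \<Union>x\<in>V - F. {\<omega> \<in> space M. (orig, x) \<in> (R \<omega>)\<^sup>*}) ` {F. finite F \<and> F \<subseteq> V} \<subseteq> sets M"
      by blast
  qed
  ultimately show ?thesis by simp
qed

lemma config_arcs_subset:
  assumes "E \<subseteq> V \<times> V" "\<omega> \<in> space (config_measure V E d p)"
  shows "config_arcs V \<omega> \<subseteq> V \<times> V"
  using assms
  by (fastforce simp: config_arcs_def config_measure_def space_PiM vertex_measure_def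
      space_point_measure PiE_iff nbrs_def)

lemma percolation_events_measurable:
  assumes "infinite_simple_digraph V E orig"
  shows "{\<omega> \<in> space (config_measure V E d p). infinite (weak_cluster V orig \<omega>)}
           \<in> sets (config_measure V E d p)"
    and "{\<omega> \<in> space (config_measure V E d p). infinite (strong_cluster V orig \<omega>)}
           \<in> sets (config_measure V E d p)"
proof -
  let ?M = "config_measure V E d p"
  have V: "countable V" and E: "E \<subseteq> V \<times> V" and o: "orig \<in> V"
    using assms by (auto simp: infinite_simple_digraph_def)
  have 1: "{\<omega> \<in> space ?M. (x, y) \<in> config_arcs V \<omega> \<union> (config_arcs V \<omega>)\<inverse>} \<in> sets ?M" for x y
    using sets.Un[OF config_arc_measurable[of V E d p x y] config_arc_measurable[of V E d p y x]]
    by (rule back_subst[of "\<lambda>A. A \<in> sets ?M"]) auto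
  have 2: "{\<omega> \<in> space ?M. (x, y) \<in> config_arcs V \<omega> \<inter> (config_arcs V \<omega>)\<inverse>} \<in> sets ?M" for x y
    using sets.Int[OF config_arc_measurable[of V E d p x y] config_arc_measurable[of V E d p y x]]
    by (rule back_subst[of "\<lambda>A. A \<in> sets ?M"]) auto
  show "{\<omega> \<in> space ?M. infinite (weak_cluster V orig \<omega>)} \<in> sets ?M"
    unfolding weak_cluster_def weakly_connected_def
    by (rule infinite_rtrancl_measurable[OF V 1 _ o]) (use config_arcs_subset[OF E] in blast)+
  show "{\<omega> \<in> space ?M. infinite (strong_cluster V orig \<omega>)} \<in> sets ?M"
    unfolding strong_cluster_def strongly_connected_def
    by (rule infinite_rtrancl_measurable[OF V 2 _ o]) (use config_arcs_subset[OF E] in blast)+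
qed

end

(* Both parts are first-moment estimates over the at most d (d - 1)^n self-avoiding walks of
   n + 1 steps from the origin.  On such a walk the states of the vertices are independent.

   Strong connection: every inner vertex must point to both of its neighbours on the walk, which
   has probability at most k (k - 1) / (d (d - 1)) + epsilon, and (d - 1) times this is below 1.

   Weak connection: summing over the orientations of the edges of the walk, an inner vertex costs 1
   if both edges point to it, q = 1 / d + epsilon if exactly one edge points away from it, and
   epsilon = s^2 if both do.  The transfer matrix [[q, 1], [s^2, q]] has the eigenvector (1, s)
   with eigenvalue q + s, so the walk is open with probability O((q + s)^n), and
   (d - 1) (q + s) < 1 for small s. *)

theory Submission
  imports Defs
begin

section \<open>Self-avoiding walks: recursion, counting, and their existence in infinite
  clusters\<close>

text \<open>Walks are listed backwards: the head is the current endpoint, the last element the start.\<close>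

definition saws :: "('v \<times> 'v) set \<Rightarrow> 'v \<Rightarrow> nat \<Rightarrow> 'v list set" where
  "saws R v n = {xs. length xs = Suc n \<and> last xs = v \<and> distinct xs \<and>
     successively (\<lambda>y x. (x, y) \<in> R) xs}"

lemma saws_mono: "R \<subseteq> R' \<Longrightarrow> saws R v n \<subseteq> saws R' v n"
  unfolding saws_def by (auto elim: successively_mono)

lemma saws_0: "saws R v 0 = {[v]}"
  by (auto simp: saws_def length_Suc_conv)

lemma saws_Suc:
  "saws R v (Suc n) = (\<Union>xs\<in>saws R v n. (\<lambda>y. y # xs) ` (nbrs R (hd xs) - set xs))"
proof (intro set_eqI iffI)
  fix zs assume *: "zs \<in> saws R v (Suc n)"
  then obtain y x xs where "zs = y # x # xs" by (auto simp: saws_def length_Suc_conv)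
  with * have "zs = y # (x # xs)" "x # xs \<in> saws R v n" "y \<in> nbrs R (hd (x # xs)) - set (x # xs)"
    by (auto simp: saws_def nbrs_def)
  then show "zs \<in> (\<Union>xs\<in>saws R v n. (\<lambda>y. y # xs) ` (nbrs R (hd xs) - set xs))"
    by blast
next
  fix zs assume "zs \<in> (\<Union>xs\<in>saws R v n. (\<lambda>y. y # xs) ` (nbrs R (hd xs) - set xs))"
  then show "zs \<in> saws R v (Suc n)"
    by (auto simp: saws_def nbrs_def successively_Cons)
qed

lemma set_saws_subset:
  assumes "xs \<in> saws R v n" "v \<in> V" "R \<subseteq> V \<times> V"
  shows "set xs \<subseteq> V"
  using assms(1)
proof (induction n arbitrary: xs)
  case (Suc n)
  then show ?case using assms(3) by (fastforce simp: saws_Suc nbrs_def)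
qed (use assms in \<open>auto simp: saws_0\<close>)

lemma finite_saws:
  assumes "\<And>x. finite (nbrs R x)"
  shows "finite (saws R v n)"
  by (induction n) (use assms in \<open>auto simp: saws_0 saws_Suc\<close>)

text \<open>The first step has at most \<open>d\<close> choices. Every later step must avoid the
  vertex it has just come from, which is a neighbour because \<open>R\<close> is symmetric; at most
  \<open>d - 1\<close> choices remain, whatever else the walk excludes.\<close>

lemma card_saws_le:
  assumes fin: "\<And>x. finite (nbrs R x)" and deg: "\<And>x. card (nbrs R x) \<le> d" and "sym R"
  shows "card (saws R v (Suc n)) \<le> d * (d - 1) ^ n"
proof (induction n)
  case 0
  have "card (nbrs R v - {v}) \<le> d"
    using card_mono[OF fin[of v], of "nbrs R v - {v}"] deg[of v] by auto
  then show ?case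
    by (auto simp: saws_Suc saws_0 intro: order_trans[OF card_image_le] fin)
next
  case (Suc n)
  have ext: "card ((\<lambda>y. y # xs) ` (nbrs R (hd xs) - set xs)) \<le> d - 1"
    if xs: "xs \<in> saws R v (Suc n)" for xs
  proof -
    from xs obtain x w zs where eq: "xs = x # w # zs" and "(w, x) \<in> R"
      by (auto simp: saws_def length_Suc_conv)
    then have w: "w \<in> nbrs R x" using \<open>sym R\<close> by (auto simp: nbrs_def dest: symD)
    have "card (nbrs R x - set xs) \<le> card (nbrs R x - {w})"
      by (rule card_mono) (use fin eq in auto)
    also have "\<dots> \<le> d - 1" using w deg[of x] by simp
    finally show ?thesis using card_image_le[of "nbrs R x - set xs" "\<lambda>y. y # xs"] fin eq
      by auto
  qed
  have "card (saws R v (Suc (Suc n))) \<le>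
      (\<Sum>xs\<in>saws R v (Suc n). card ((\<lambda>y. y # xs) ` (nbrs R (hd xs) - set xs)))"
    unfolding saws_Suc[of R v "Suc n"] by (rule card_UN_le[OF finite_saws[OF fin]])
  also have "\<dots> \<le> card (saws R v (Suc n)) * (d - 1)"
    using sum_bounded_above[of "saws R v (Suc n)", OF ext] by simp
  also have "\<dots> \<le> d * (d - 1) ^ n * (d - 1)"
    by (rule mult_right_mono[OF Suc.IH]) simp
  finally show ?case by (simp add: mult_ac)
qed

lemma saws_tl:
  assumes "xs \<in> saws R v (Suc n)"
  shows "tl xs \<in> saws R v n"
  using assms by (auto simp: saws_Suc)

text \<open>Since the head is the current endpoint, dropping \<open>k\<close> entries retracts the
  last \<open>k\<close> steps and keeps the start \<open>v\<close>.\<close>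

lemma saws_drop:
  assumes "xs \<in> saws R v (n + k)"
  shows "drop k xs \<in> saws R v n"
  using assms
proof (induction k arbitrary: xs)
  case (Suc k)
  then show ?case using saws_tl[of xs R v "n + k"] by (simp add: drop_Suc)
qed simp

text \<open>Loop erasure, performed step by step along the path.\<close>

lemma rtrancl_imp_saw:
  assumes "(v, x) \<in> R\<^sup>*"
  shows "\<exists>n. \<exists>xs\<in>saws R v n. hd xs = x"
  using assms
proof induction
  case base
  then show ?case by (auto simp: saws_0 intro!: exI[of _ 0])
next
  case (step x y)
  then obtain n xs where xs: "xs \<in> saws R v n" "hd xs = x" by blast
  show ?case
  proof (cases "y \<in> set xs")
    case False
    then have "y # xs \<in> saws R v (Suc n)" using step xs by (auto simp: saws_Suc nbrs_def)
    then show ?thesis by force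
  next
    case True
    \<comment> \<open>The path has returned to \<open>y\<close>, so the walk is cut back to its
      earlier visit there.\<close>
    then obtain k where k: "k < length xs" "xs ! k = y" by (auto simp: in_set_conv_nth)
    moreover have "length xs = Suc n" using xs by (simp add: saws_def)
    ultimately have "drop k xs \<in> saws R v (n - k)" using xs by (intro saws_drop) simp
    moreover have "hd (drop k xs) = y" using k by (simp add: hd_drop_conv_nth)
    ultimately show ?thesis by blast
  qed
qed

text \<open>A walk with more than \<open>n\<close> steps can be retracted to exactly
  \<open>n\<close>. If no walk has \<open>n\<close> steps, every vertex of the cluster is therefore
  the endpoint of one of the finitely many shorter walks.\<close>

lemma infinite_cluster_imp_saw:
  assumes inf: "infinite {x. (v, x) \<in> R\<^sup>*}" and fin: "\<And>x. finite (nbrs R x)"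
  shows "saws R v n \<noteq> {}"
proof
  assume empty: "saws R v n = {}"
  have "{x. (v, x) \<in> R\<^sup>*} \<subseteq> (\<Union>m<n. hd ` saws R v m)"
  proof safe
    fix x assume "(v, x) \<in> R\<^sup>*"
    then obtain m xs where xs: "xs \<in> saws R v m" "hd xs = x"
      using rtrancl_imp_saw by metis
    have "m < n"
    proof (rule ccontr)
      assume "\<not> m < n"
      then have "drop (m - n) xs \<in> saws R v n" using xs by (intro saws_drop) simp
      with empty show False by simp
    qed
    with xs show "x \<in> (\<Union>m<n. hd ` saws R v m)" by auto
  qed
  moreover have "finite (\<Union>m<n. hd ` saws R v m)" using finite_saws[OF fin] by blast
  ultimately show False using inf finite_subset by blast
qed

section \<open>Auxiliary facts: counting supersets, and geometric decay\<close>

text \<open>The left side is the chance that a uniform \<open>i\<close>-subset of \<open>L\<close>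
  contains \<open>B\<close>. Double counting of nested pairs (\<open>choose_mult\<close>) moves
  \<open>i\<close> into a single numerator, from which monotonicity in \<open>i\<close> can be read
  off.\<close>

lemma card_supersets_of_card:
  assumes "finite L" "B \<subseteq> L" "i \<le> card L"
  shows "real (card {S. S \<subseteq> L \<and> B \<subseteq> S \<and> card S = i}) / real (card L choose i)
    = real (i choose card B) / real (card L choose card B)"
proof (cases "card B \<le> i")
  case True
  have fB: "finite B" using assms finite_subset by blast
  have bL: "card B \<le> card L" using assms card_mono by blast
  have "bij_betw (\<lambda>T. T \<union> B) {T. T \<subseteq> L - B \<and> card T = i - card B}
      {S. S \<subseteq> L \<and> B \<subseteq> S \<and> card S = i}"
  proof (rule bij_betwI[where g = "\<lambda>S. S - B"])
    show "(\<lambda>T. T \<union> B) \<in> {T. T \<subseteq> L - B \<and> card T = i - card B} \<rightarrow>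
        {S. S \<subseteq> L \<and> B \<subseteq> S \<and> card S = i}"
    proof (rule funcsetI, clarify, intro conjI)
      fix T assume T: "T \<subseteq> L - B" "card T = i - card B"
      then have "finite T" using assms finite_subset by blast
      moreover have "T \<inter> B = {}" using T by blast
      ultimately show "card (T \<union> B) = i" using True T fB by (simp add: card_Un_disjoint)
    qed (use assms in auto)
    show "(\<lambda>S. S - B) \<in> {S. S \<subseteq> L \<and> B \<subseteq> S \<and> card S = i} \<rightarrow>
        {T. T \<subseteq> L - B \<and> card T = i - card B}"
      using fB by (auto simp: card_Diff_subset)
  qed auto
  then have "card {S. S \<subseteq> L \<and> B \<subseteq> S \<and> card S = i} = (card L - card B) choose (i - card B)"
    using assms fB by (simp add: bij_betw_same_card[symmetric] n_subsets card_Diff_subset)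
  moreover have "(card L choose i) * (i choose card B) =
      (card L choose card B) * ((card L - card B) choose (i - card B))"
    by (rule choose_mult) (use True assms in auto)
  then have "real (card L choose i) * real (i choose card B) =
      real (card L choose card B) * real ((card L - card B) choose (i - card B))"
    by (metis of_nat_mult)
  ultimately show ?thesis using assms(3) bL by (simp add: field_simps)
next
  case False
  then have "{S. S \<subseteq> L \<and> B \<subseteq> S \<and> card S = i} = {}"
    using assms by (auto dest: card_mono[rotated] finite_subset)
  then show ?thesis using False by (simp only: card.empty binomial_eq_0 not_le)
qed

text \<open>Turns a bound available for every walk length into probability zero.\<close>

lemma nonpos_if_le_geometric:
  fixes a :: real
  assumes "\<And>n. a \<le> K * t ^ n" and "0 \<le> t" "t < 1"
  shows "a \<le> 0"
proof (rule LIMSEQ_le_const)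
  show "(\<lambda>n. K * t ^ n) \<longlonglongrightarrow> 0"
    using assms(2,3) by (intro tendsto_mult_right_zero LIMSEQ_realpow_zero)
qed (use assms(1) in blast)

section \<open>The percolation measure: marginals and cylinder probabilities\<close>

locale percolation =
  fixes V :: "'v set" and E :: "('v \<times> 'v) set" and d :: nat and p :: "nat \<Rightarrow> real"
  assumes arcs: "E \<subseteq> V \<times> V" and sym: "sym E"
    and regular: "regular_graph V E d" and prob_vector: "prob_vector d p"
begin

abbreviation "M \<equiv> config_measure V E d p"

sublocale prob_space M
  by (rule prob_space_config_measure[OF regular prob_vector])

definition marginal :: "'v \<Rightarrow> 'v set \<Rightarrow> real" where
  "marginal x B = measure (vertex_measure E d p x) {S. S \<subseteq> nbrs E x \<and> B \<subseteq> S}"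

text \<open>States are bounded only from below, and \<open>c\<close> matters only on
  \<open>J\<close>; inserting a new vertex into \<open>J\<close> and updating \<open>c\<close> there
  leaves the earlier requirements intact.\<close>

definition cylinder :: "'v set \<Rightarrow> ('v \<Rightarrow> 'v set) \<Rightarrow> ('v \<Rightarrow> 'v set) set" where
  "cylinder J c = {\<omega> \<in> space M. \<forall>z\<in>J. c z \<subseteq> \<omega> z}"

text \<open>Gives the degree bounds below for every element of the type, which is the form that the
  walk lemmas ask for.\<close>

lemma nbrs_outside: "x \<notin> V \<Longrightarrow> nbrs E x = {}"
  using arcs by (auto simp: nbrs_def)

lemma finite_nbrs: "finite (nbrs E x)"
  using regular nbrs_outside by (cases "x \<in> V") (auto simp: regular_graph_def)

lemma card_nbrs_le: "card (nbrs E x) \<le> d"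
  using regular nbrs_outside by (cases "x \<in> V") (auto simp: regular_graph_def)

lemma config_subset_nbrs:
  assumes "\<omega> \<in> space M" "x \<in> V"
  shows "\<omega> x \<subseteq> nbrs E x"
  using assms
  by (auto simp: config_measure_def space_PiM vertex_measure_def space_point_measure PiE_iff)

lemma sets_vertex_measure [simp]: "sets (vertex_measure E d p x) = Pow (Pow (nbrs E x))"
  by (simp add: vertex_measure_def sets_point_measure)

lemma vertex_prob_space: "x \<in> V \<Longrightarrow> prob_space (vertex_measure E d p x)"
  by (rule prob_space_vertex_measure) (use regular prob_vector in \<open>auto simp: regular_graph_def\<close>)

text \<open>Given its size \<open>i\<close>, the state is uniform among the
  \<open>i\<close>-subsets, so grouping states by size leaves the superset ratio.\<close>

lemma marginal_eq:
  assumes x: "x \<in> V" and B: "B \<subseteq> nbrs E x"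
  shows "marginal x B = (\<Sum>i\<le>d. p i * (real (i choose card B) / real (d choose card B)))"
proof -
  let ?L = "nbrs E x"
  let ?A = "{S. S \<subseteq> ?L \<and> B \<subseteq> S}"
  let ?f = "\<lambda>S :: 'v set. p (card S) / real (d choose card S)"
  have card: "card ?L = d" using x regular by (auto simp: regular_graph_def)
  have le: "card S \<le> d" if "S \<subseteq> ?L" for S
    using that card_mono[OF finite_nbrs, of S x] card by auto
  have fin: "finite ?A" by (rule finite_subset[of _ "Pow ?L"]) (auto simp: finite_nbrs)
  have nn: "0 \<le> ?f S" if "S \<in> Pow ?L" for S
    using le[of S] that prob_vector by (auto simp: prob_vector_def)
  have "marginal x B = (\<Sum>S\<in>?A. ?f S)"
    unfolding marginal_def vertex_measure_def
    using nn by (subst measure_point_measure_finite_if) (auto simp: finite_nbrs)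
  also have "\<dots> = (\<Sum>i\<le>d. \<Sum>S\<in>{S \<in> ?A. card S = i}. ?f S)"
    by (rule sum.group[symmetric]) (use fin le in auto)
  also have "\<dots> = (\<Sum>i\<le>d. \<Sum>S\<in>{S \<in> ?A. card S = i}. p i / real (d choose i))"
    by (intro sum.cong refl) auto
  also have "\<dots> = (\<Sum>i\<le>d. p i * (real (card {S. S \<subseteq> ?L \<and> B \<subseteq> S \<and> card S = i}) / real (d choose i)))"
    by (intro sum.cong refl) (simp add: conj_assoc)
  also have "\<dots> = (\<Sum>i\<le>d. p i * (real (i choose card B) / real (d choose card B)))"
    by (intro sum.cong refl)
      (use card_supersets_of_card[OF finite_nbrs B] card in simp)
  finally show ?thesis .
qed

lemma sum_p_le_1:
  assumes "k \<le> d"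
  shows "(\<Sum>i\<le>k. p i) \<le> 1"
proof -
  have "(\<Sum>i\<le>k. p i) \<le> (\<Sum>i\<le>d. p i)"
    by (rule sum_mono2) (use assms prob_vector in \<open>auto simp: prob_vector_def\<close>)
  then show ?thesis using prob_vector by (simp add: prob_vector_def)
qed

text \<open>The superset ratio increases with \<open>i\<close> and never exceeds 1. Sizes up to
  \<open>k\<close> are charged the ratio at \<open>k\<close>, larger ones are charged 1.\<close>

lemma marginal_le:
  assumes x: "x \<in> V" and B: "B \<subseteq> nbrs E x" and k: "k \<le> d"
  shows "marginal x B \<le> real (k choose card B) / real (d choose card B) + (1 - (\<Sum>i\<le>k. p i))"
proof -
  let ?r = "\<lambda>i. real (i choose card B) / real (d choose card B)"
  have r: "?r i \<le> ?r j" if "i \<le> j" for i j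
    using that by (intro divide_right_mono) (auto intro: binomial_right_mono)
  have r1: "?r d \<le> 1" by simp
  have p0: "0 \<le> p i" if "i \<le> d" for i using that prob_vector by (simp add: prob_vector_def)
  have split: "sum g {..d} = sum g {..k} + sum g {k<..d}" for g :: "nat \<Rightarrow> real"
    by (subst sum.union_disjoint[symmetric]) (use k in \<open>auto intro: sum.cong\<close>)
  have "sum p {..k} \<le> 1" by (rule sum_p_le_1[OF k])
  have "marginal x B = (\<Sum>i\<le>k. p i * ?r i) + (\<Sum>i\<in>{k<..d}. p i * ?r i)"
    unfolding marginal_eq[OF x B] by (rule split)
  also have "(\<Sum>i\<le>k. p i * ?r i) \<le> (\<Sum>i\<le>k. p i * ?r k)"
    by (intro sum_mono mult_left_mono r p0) (use k in auto)
  also have "\<dots> = sum p {..k} * ?r k" by (rule sum_distrib_right[symmetric])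
  also have "\<dots> \<le> 1 * ?r k" by (rule mult_right_mono) (use \<open>sum p {..k} \<le> 1\<close> in auto)
  also have "(\<Sum>i\<in>{k<..d}. p i * ?r i) \<le> (\<Sum>i\<in>{k<..d}. p i * 1)"
    by (intro sum_mono mult_left_mono order_trans[OF r r1] p0) auto
  also have "(\<Sum>i\<in>{k<..d}. p i * 1) = 1 - sum p {..k}"
    using split[of p] prob_vector by (simp add: prob_vector_def)
  finally show ?thesis by simp
qed

text \<open>The only appeal to independence: a cylinder is a finite-dimensional box with one event
  per vertex of \<open>J\<close>.\<close>

lemma cylinder_sets :
  assumes "finite J" "J \<subseteq> V"
  shows "cylinder J c \<in> sets M"
    and "measure M (cylinder J c) = (\<Prod>z\<in>J. marginal z (c z))"
proof -
  let ?X = "\<lambda>z. {S. S \<subseteq> nbrs E z \<and> c z \<subseteq> S}"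
  let ?N = "vertex_measure E d p"
  have X: "?X z \<in> sets (?N z)" for z by auto
  have eq: "cylinder J c = prod_emb V ?N J (Pi\<^sub>E J ?X)"
    using assms config_subset_nbrs
    by (fastforce simp: cylinder_def prod_emb_def config_measure_def space_PiM PiE_iff)
  show "cylinder J c \<in> sets M"
    unfolding eq config_measure_def by (rule sets_PiM_I) (use assms X in auto)
  \<comment> \<open>The marginals outside \<open>V\<close> are not probability measures.\<close>
  let ?N' = "\<lambda>z. if z \<in> V then ?N z else count_space {undefined}"
  interpret N': prob_space "?N' z" for z
    using vertex_prob_space by (cases "z \<in> V") (auto intro!: prob_spaceI)
  interpret N': product_prob_space ?N' V ..
  have "measure (PiM V ?N') (prod_emb V ?N' J (Pi\<^sub>E J ?X)) = (\<Prod>z\<in>J. measure (?N' z) (?X z))"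
    by (rule N'.measure_PiM_emb) (use assms in auto)
  moreover have "PiM V ?N' = M"
    unfolding config_measure_def by (rule PiM_cong) auto
  moreover have "prod_emb V ?N' J (Pi\<^sub>E J ?X) = cylinder J c"
    unfolding eq prod_emb_def by (auto simp: PiE_iff)
  moreover have "(\<Prod>z\<in>J. measure (?N' z) (?X z)) = (\<Prod>z\<in>J. marginal z (c z))"
    unfolding marginal_def by (intro prod.cong) (use assms in auto)
  ultimately show "measure M (cylinder J c) = (\<Prod>z\<in>J. marginal z (c z))" by simp
qed

lemma cylinder_insert:
  assumes "x \<notin> J"
  shows "cylinder (insert x J) (c(x := B)) = {\<omega> \<in> cylinder J c. B \<subseteq> \<omega> x}"
  using assms by (auto simp: cylinder_def)

lemma measure_cylinder_insert:
  assumes "finite J" "insert x J \<subseteq> V" "x \<notin> J"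
  shows "measure M (cylinder (insert x J) (c(x := B))) = measure M (cylinder J c) * marginal x B"
  using assms by (subst (1 2) cylinder_sets(2)) (auto intro!: prod.cong)

section \<open>Measurability of the walk events\<close>

lemma sets_arc [measurable]:
  assumes "x \<in> V"
  shows "{\<omega> \<in> space M. y \<in> \<omega> x} \<in> sets M"
  using cylinder_sets(1)[of "{x}" "\<lambda>_. {y}"] assms by (simp add: cylinder_def)

lemma sets_successively:
  assumes "\<And>x y. x \<in> V \<Longrightarrow> y \<in> V \<Longrightarrow> {\<omega> \<in> space M. Q \<omega> y x} \<in> sets M" and "set xs \<subseteq> V"
  shows "{\<omega> \<in> space M. successively (Q \<omega>) xs} \<in> sets M"
  using assms(2)
proof (induction xs rule: induct_list012)
  case (3 y x xs)
  have "{\<omega> \<in> space M. successively (Q \<omega>) (y # x # xs)} =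
      {\<omega> \<in> space M. Q \<omega> y x} \<inter> {\<omega> \<in> space M. successively (Q \<omega>) (x # xs)}"
    by auto
  also have "\<dots> \<in> sets M" using 3 assms(1) by (intro sets.Int) auto
  finally show ?case .
qed auto

lemma sets_strong_walk:
  assumes "set xs \<subseteq> V"
  shows "{\<omega> \<in> space M. successively (\<lambda>y x. y \<in> \<omega> x \<and> x \<in> \<omega> y) xs} \<in> sets M"
  by (rule sets_successively) (use assms in auto)

lemma sets_weak_walk:
  assumes "set xs \<subseteq> V"
  shows "{\<omega> \<in> space M. successively (\<lambda>y x. y \<in> \<omega> x \<or> x \<in> \<omega> y) xs} \<in> sets M"
  by (rule sets_successively) (use assms in auto)

lemma sets_cylinder_walk:
  assumes "finite J" "J \<subseteq> V" "x \<in> V" and A: "{\<omega> \<in> space M. P \<omega>} \<in> sets M"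
  shows "{\<omega> \<in> cylinder J c. P \<omega>} \<in> sets M" "{\<omega> \<in> cylinder J c. y \<in> \<omega> x \<and> P \<omega>} \<in> sets M"
proof -
  have "{\<omega> \<in> cylinder J c. P \<omega>} = cylinder J c \<inter> {\<omega> \<in> space M. P \<omega>}"
    "{\<omega> \<in> cylinder J c. y \<in> \<omega> x \<and> P \<omega>} =
      cylinder J c \<inter> ({\<omega> \<in> space M. y \<in> \<omega> x} \<inter> {\<omega> \<in> space M. P \<omega>})"
    by (auto simp: cylinder_def)
  then show "{\<omega> \<in> cylinder J c. P \<omega>} \<in> sets M" "{\<omega> \<in> cylinder J c. y \<in> \<omega> x \<and> P \<omega>} \<in> sets M"
    using assms cylinder_sets(1) sets_arc by auto
qed

section \<open>Probability bounds for a single walk\<close>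

text \<open>In both walk estimates the cylinder records the states of the vertices already peeled off, so
  that independence enters only through the product formula for cylinders.\<close>

lemma measure_strong_walk_le:
  assumes pair: "\<And>x u v. x \<in> V \<Longrightarrow> u \<in> nbrs E x \<Longrightarrow> v \<in> nbrs E x \<Longrightarrow> u \<noteq> v \<Longrightarrow>
      marginal x {u, v} \<le> r" and "0 \<le> r"
  assumes "successively (\<lambda>y x. (x, y) \<in> E) (y # x # xs)" "distinct (y # x # xs)"
    and "finite J" "J \<subseteq> V" "J \<inter> set (x # xs) = {}" "set (x # xs) \<subseteq> V"
  shows "measure M {\<omega> \<in> cylinder J c. y \<in> \<omega> x \<and>
      successively (\<lambda>y x. y \<in> \<omega> x \<and> x \<in> \<omega> y) (x # xs)} \<le> measure M (cylinder J c) * r ^ length xs"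
  using assms(3-)
proof (induction xs arbitrary: x y J c)
  case Nil
  \<comment> \<open>The start of the walk is charged 1, so the exponent counts inner vertices
    only.\<close>
  have "measure M {\<omega> \<in> cylinder J c. y \<in> \<omega> x} \<le> measure M (cylinder J c)"
    by (rule finite_measure_mono) (use cylinder_sets(1) Nil in auto)
  then show ?case by simp
next
  case (Cons w xs)
  \<comment> \<open>The state of \<open>x\<close> is fully paid for here: it points to both walk
    neighbours \<open>y\<close> and \<open>w\<close>. The reverse arc from \<open>w\<close> to
    \<open>x\<close> is handed to the induction hypothesis, with \<open>x\<close> in the role of
    \<open>y\<close>.\<close>
  let ?J = "insert x J" and ?c = "c(x := {y, w})"
  let ?B = "{\<omega> \<in> cylinder ?J ?c. x \<in> \<omega> w \<and>
      successively (\<lambda>y x. y \<in> \<omega> x \<and> x \<in> \<omega> y) (w # xs)}"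
  have "measure M {\<omega> \<in> cylinder J c. y \<in> \<omega> x \<and>
      successively (\<lambda>y x. y \<in> \<omega> x \<and> x \<in> \<omega> y) (x # w # xs)} \<le> measure M ?B"
  proof (rule finite_measure_mono)
    show "?B \<in> sets M"
      by (intro sets_cylinder_walk sets_strong_walk) (use Cons.prems in auto)
  qed (use Cons.prems in \<open>auto simp: cylinder_insert\<close>)
  also have "\<dots> \<le> measure M (cylinder ?J ?c) * r ^ length xs"
    by (rule Cons.IH) (use Cons.prems in auto)
  also have "measure M (cylinder ?J ?c) = measure M (cylinder J c) * marginal x {y, w}"
    by (rule measure_cylinder_insert) (use Cons.prems in auto)
  also have "\<dots> * r ^ length xs \<le> (measure M (cylinder J c) * r) * r ^ length xs"
    by (intro mult_right_mono mult_left_mono pair)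
      (use Cons.prems \<open>0 \<le> r\<close> sym in \<open>auto simp: nbrs_def dest: symD\<close>)
  finally show ?case by (simp add: mult_ac)
qed

text \<open>The two conclusions are the components of the transfer-matrix vector: \<open>x\<close>
  free, and \<open>x\<close> obliged to point to \<open>y\<close>. Each recursion uses both, hence
  the joint induction. The eigenvector is rescaled to \<open>(1/s, 1)\<close>.\<close>

lemma measure_weak_walk_le:
  assumes single: "\<And>x u. x \<in> V \<Longrightarrow> u \<in> nbrs E x \<Longrightarrow> marginal x {u} \<le> q"
    and pair: "\<And>x u v. x \<in> V \<Longrightarrow> u \<in> nbrs E x \<Longrightarrow> v \<in> nbrs E x \<Longrightarrow> u \<noteq> v \<Longrightarrow>
      marginal x {u, v} \<le> s\<^sup>2"
    and "0 \<le> q" "0 < s" "s \<le> 1"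
  assumes "successively (\<lambda>y x. (x, y) \<in> E) (x # xs)" "distinct (x # xs)"
    and "finite J" "J \<subseteq> V" "J \<inter> set (x # xs) = {}" "set (x # xs) \<subseteq> V"
  shows "measure M {\<omega> \<in> cylinder J c. successively (\<lambda>y x. y \<in> \<omega> x \<or> x \<in> \<omega> y) (x # xs)}
      \<le> measure M (cylinder J c) * ((q + s) ^ length xs / s)" (is ?thesis1)
    and "y \<in> nbrs E x - set (x # xs) \<Longrightarrow>
      measure M {\<omega> \<in> cylinder J c. y \<in> \<omega> x \<and>
        successively (\<lambda>y x. y \<in> \<omega> x \<or> x \<in> \<omega> y) (x # xs)}
      \<le> measure M (cylinder J c) * (q + s) ^ length xs" (is "_ \<Longrightarrow> ?thesis2")
proof -
  let ?W = "\<lambda>\<omega>. successively (\<lambda>y x. y \<in> \<omega> x \<or> x \<in> \<omega> y)"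
  have "?thesis1 \<and> (y \<in> nbrs E x - set (x # xs) \<longrightarrow> ?thesis2)"
    using assms(6-)
  proof (induction xs arbitrary: x y J c)
    case Nil
    have "measure M {\<omega> \<in> cylinder J c. y \<in> \<omega> x} \<le> measure M (cylinder J c)"
      by (rule finite_measure_mono) (use cylinder_sets(1) Nil in auto)
    \<comment> \<open>The initial vector \<open>(1, 1)\<close> lies below \<open>(1/s, 1)\<close>
      because \<open>s\<close> is at most 1.\<close>
    moreover have "measure M (cylinder J c) * 1 \<le> measure M (cylinder J c) * (1 / s)"
      by (rule mult_left_mono) (use \<open>0 < s\<close> \<open>s \<le> 1\<close> in auto)
    ultimately show ?case by simp
  next
    case (Cons w xs)
    let ?K = "measure M (cylinder J c)" and ?l = "(q + s) ^ length xs"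
    have l0: "0 \<le> ?l" using \<open>0 \<le> q\<close> \<open>0 < s\<close> by simp
    have x: "x \<in> V" "x \<notin> J" "w \<in> nbrs E x" "x \<in> nbrs E w - set (w # xs)"
      using Cons.prems sym by (auto simp: nbrs_def dest: symD)
    have walk: "successively (\<lambda>y x. (x, y) \<in> E) (w # xs)" "distinct (w # xs)"
      "set (w # xs) \<subseteq> V" "finite (insert x J)" "insert x J \<subseteq> V" "insert x J \<inter> set (w # xs) = {}"
      "J \<inter> set (w # xs) = {}" "w \<in> V"
      using Cons.prems by auto
    note IH = Cons.IH[OF walk(1,2) _ _ _ walk(3)]
    \<comment> \<open>Once \<open>x\<close> opens the edge to \<open>w\<close>, nothing is demanded
      of \<open>w\<close> by that edge, so the free bound applies to the rest.\<close>
    have in_first: "measure M {\<omega> \<in> cylinder (insert x J) (c(x := B)). ?W \<omega> (w # xs)}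
        \<le> ?K * m * (?l / s)" if "marginal x B \<le> m" for B m
    proof -
      have "measure M {\<omega> \<in> cylinder (insert x J) (c(x := B)). ?W \<omega> (w # xs)}
          \<le> measure M (cylinder (insert x J) (c(x := B))) * (?l / s)"
        using IH[of "insert x J" "c(x := B)"] walk by blast
      also have "measure M (cylinder (insert x J) (c(x := B))) = ?K * marginal x B"
        using measure_cylinder_insert Cons.prems x by auto
      also have "\<dots> * (?l / s) \<le> ?K * m * (?l / s)"
        by (intro mult_right_mono mult_left_mono that) (use l0 \<open>0 < s\<close> in auto)
      finally show ?thesis .
    qed
    have sets: "{\<omega> \<in> cylinder J' c'. ?W \<omega> (w # xs)} \<in> sets M"
      "{\<omega> \<in> cylinder J' c'. x \<in> \<omega> w \<and> ?W \<omega> (w # xs)} \<in> sets M"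
      if "finite J'" "J' \<subseteq> V" for J' c'
      using sets_cylinder_walk[OF that \<open>w \<in> V\<close> sets_weak_walk[OF walk(3)]] by auto
    \<comment> \<open>Split by which end opens the edge between \<open>x\<close> and
      \<open>w\<close>. If it is \<open>w\<close>, the state of \<open>x\<close> stays unconstrained
      and the cylinder does not grow.\<close>
    have "measure M {\<omega> \<in> cylinder J c. ?W \<omega> (x # w # xs)}
        \<le> measure M ({\<omega> \<in> cylinder (insert x J) (c(x := {w})). ?W \<omega> (w # xs)} \<union>
            {\<omega> \<in> cylinder J c. x \<in> \<omega> w \<and> ?W \<omega> (w # xs)})"
      by (rule finite_measure_mono[OF _ sets.Un[OF sets(1) sets(2)]])
        (use x Cons.prems in \<open>auto simp: cylinder_insert\<close>)
    also have "\<dots> \<le> measure M {\<omega> \<in> cylinder (insert x J) (c(x := {w})). ?W \<omega> (w # xs)} +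
        measure M {\<omega> \<in> cylinder J c. x \<in> \<omega> w \<and> ?W \<omega> (w # xs)}"
      by (rule measure_Un_le) (intro sets; use Cons.prems walk in simp)+
    also have "\<dots> \<le> ?K * q * (?l / s) + ?K * ?l"
      using in_first[OF single[OF x(1,3)]] IH[of J c x] x Cons.prems walk
      by (intro add_mono) blast+
    \<comment> \<open>First row of the eigenvector equation:
      \<open>q * (1/s) + 1 = (q + s) / s\<close>.\<close>
    also have "\<dots> = ?K * ((q + s) ^ length (w # xs) / s)"
      using \<open>0 < s\<close> by (simp add: field_simps)
    finally have 1: "measure M {\<omega> \<in> cylinder J c. ?W \<omega> (x # w # xs)} \<le> \<dots>" .
    have 2: "measure M {\<omega> \<in> cylinder J c. y \<in> \<omega> x \<and> ?W \<omega> (x # w # xs)}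
        \<le> ?K * (q + s) ^ length (w # xs)" if y: "y \<in> nbrs E x - set (x # w # xs)"
    proof -
      \<comment> \<open>The same split, with \<open>x\<close> already pointing to \<open>y\<close>:
        it costs \<open>s\<^sup>2\<close> if \<open>x\<close> also points to \<open>w\<close>, and
        \<open>q\<close> if \<open>w\<close> opens the edge.\<close>
      have "measure M {\<omega> \<in> cylinder J c. y \<in> \<omega> x \<and> ?W \<omega> (x # w # xs)}
          \<le> measure M ({\<omega> \<in> cylinder (insert x J) (c(x := {y, w})). ?W \<omega> (w # xs)} \<union>
              {\<omega> \<in> cylinder (insert x J) (c(x := {y})). x \<in> \<omega> w \<and> ?W \<omega> (w # xs)})"
        by (rule finite_measure_mono[OF _ sets.Un[OF sets(1) sets(2)]])
          (use x Cons.prems in \<open>auto simp: cylinder_insert\<close>)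
      also have "\<dots> \<le> measure M {\<omega> \<in> cylinder (insert x J) (c(x := {y, w})). ?W \<omega> (w # xs)} +
          measure M {\<omega> \<in> cylinder (insert x J) (c(x := {y})). x \<in> \<omega> w \<and> ?W \<omega> (w # xs)}"
        by (rule measure_Un_le) (intro sets; use walk in simp)+
      also have "\<dots> \<le> ?K * s\<^sup>2 * (?l / s) +
          measure M (cylinder (insert x J) (c(x := {y}))) * ?l"
      proof (rule add_mono)
        show "measure M {\<omega> \<in> cylinder (insert x J) (c(x := {y, w})). ?W \<omega> (w # xs)}
            \<le> ?K * s\<^sup>2 * (?l / s)"
          by (rule in_first[OF pair]) (use x y in auto)
        show "measure M {\<omega> \<in> cylinder (insert x J) (c(x := {y})). x \<in> \<omega> w \<and> ?W \<omega> (w # xs)}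
            \<le> measure M (cylinder (insert x J) (c(x := {y}))) * ?l"
          using IH[of "insert x J" "c(x := {y})" x] x walk by blast
      qed
      also have "measure M (cylinder (insert x J) (c(x := {y}))) = ?K * marginal x {y}"
        using measure_cylinder_insert Cons.prems x by auto
      also have "?K * s\<^sup>2 * (?l / s) + ?K * marginal x {y} * ?l \<le> ?K * s\<^sup>2 * (?l / s) + ?K * q * ?l"
        by (intro add_left_mono mult_right_mono mult_left_mono single) (use l0 x y in auto)
      \<comment> \<open>Second row: \<open>s\<^sup>2 * (1/s) + q = q + s\<close>.\<close>
      also have "\<dots> = ?K * (q + s) ^ length (w # xs)"
        using \<open>0 < s\<close> by (simp add: field_simps power2_eq_square)
      finally show ?thesis .
    qed
    show ?case using 1 2 by blast
  qed
  then show ?thesis1 "y \<in> nbrs E x - set (x # xs) \<Longrightarrow> ?thesis2" by auto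
qed

section \<open>Union bound over walks, and vanishing of both percolation probabilities\<close>

text \<open>An infinite cluster contains an open self-avoiding walk of every length. The random
  relation \<open>R\<close> is kept abstract so that the union bound serves weak and strong
  connection alike.\<close>

lemma measure_infinite_cluster_le:
  assumes R: "\<And>\<omega>. \<omega> \<in> space M \<Longrightarrow> R \<omega> \<subseteq> E"
    and sets: "\<And>x y. x \<in> V \<Longrightarrow> y \<in> V \<Longrightarrow> {\<omega> \<in> space M. (x, y) \<in> R \<omega>} \<in> sets M"
    and bound: "\<And>xs. xs \<in> saws E v (Suc n) \<Longrightarrow>
      measure M {\<omega> \<in> space M. successively (\<lambda>y x. (x, y) \<in> R \<omega>) xs} \<le> b"
    and v: "v \<in> V" and b: "0 \<le> b"
  shows "measure M {\<omega> \<in> space M. infinite {x \<in> V. (v, x) \<in> (R \<omega>)\<^sup>*}} \<le> real (d * (d - 1) ^ n) * b"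
proof -
  let ?S = "saws E v (Suc n)"
  let ?O = "\<lambda>xs. {\<omega> \<in> space M. successively (\<lambda>y x. (x, y) \<in> R \<omega>) xs}"
  have fin: "finite ?S" by (rule finite_saws[OF finite_nbrs])
  have O: "?O xs \<in> sets M" if "xs \<in> ?S" for xs
    by (rule sets_successively[OF sets]) (use that set_saws_subset[OF _ v arcs] in auto)
  have "{\<omega> \<in> space M. infinite {x \<in> V. (v, x) \<in> (R \<omega>)\<^sup>*}} \<subseteq> (\<Union>xs\<in>?S. ?O xs)"
  proof clarify
    fix \<omega> assume \<omega>: "\<omega> \<in> space M" and inf: "infinite {x \<in> V. (v, x) \<in> (R \<omega>)\<^sup>*}"
    have "infinite {x. (v, x) \<in> (R \<omega>)\<^sup>*}" by (rule infinite_super[OF _ inf]) auto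
    moreover have "finite (nbrs (R \<omega>) x)" for x
      by (rule finite_subset[OF _ finite_nbrs[of x]]) (use R[OF \<omega>] in \<open>auto simp: nbrs_def\<close>)
    ultimately obtain xs where xs: "xs \<in> saws (R \<omega>) v (Suc n)"
      using infinite_cluster_imp_saw[of v "R \<omega>" "Suc n"] by blast
    then have "xs \<in> ?S" using saws_mono[OF R[OF \<omega>]] by blast
    moreover have "\<omega> \<in> ?O xs" using xs \<omega> by (simp add: saws_def)
    ultimately show "\<omega> \<in> (\<Union>xs\<in>?S. ?O xs)" by blast
  qed
  then have "measure M {\<omega> \<in> space M. infinite {x \<in> V. (v, x) \<in> (R \<omega>)\<^sup>*}} \<le> measure M (\<Union>xs\<in>?S. ?O xs)"
    by (rule finite_measure_mono) (use O fin in auto)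
  also have "\<dots> \<le> (\<Sum>xs\<in>?S. measure M (?O xs))"
    by (rule measure_UNION_le[OF fin O])
  also have "\<dots> \<le> real (card ?S) * b" by (rule sum_bounded_above[OF bound])
  also have "\<dots> \<le> real (d * (d - 1) ^ n) * b"
    by (intro mult_right_mono b) (use card_saws_le[OF finite_nbrs card_nbrs_le sym, of v n] in linarith)
  finally show ?thesis .
qed

lemma config_arcs_subset_E:
  assumes "\<omega> \<in> space M"
  shows "config_arcs V \<omega> \<subseteq> E"
  using config_subset_nbrs[OF assms] by (auto simp: config_arcs_def nbrs_def)

lemma strong_theta_eq_0:
  assumes v: "v \<in> V" and k: "k \<le> d"
  defines "r \<equiv> real (k choose 2) / real (d choose 2) + (1 - (\<Sum>i\<le>k. p i))"
  assumes r: "real (d - 1) * r < 1"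
  shows "strong_theta V E v d p = 0"
proof -
  let ?R = "\<lambda>\<omega>. config_arcs V \<omega> \<inter> (config_arcs V \<omega>)\<inverse>"
  have r0: "0 \<le> r" using sum_p_le_1[OF k] by (simp add: r_def)
  have pair: "marginal x {u, w} \<le> r" if "x \<in> V" "u \<in> nbrs E x" "w \<in> nbrs E x" "u \<noteq> w" for x u w
    using marginal_le[of x "{u, w}" k] that k by (simp add: r_def numeral_2_eq_2)
  have "measure M {\<omega> \<in> space M. infinite {x \<in> V. (v, x) \<in> (?R \<omega>)\<^sup>*}} \<le> real d * (real (d - 1) * r) ^ n"
    for n
  proof -
    have "measure M {\<omega> \<in> space M. infinite {x \<in> V. (v, x) \<in> (?R \<omega>)\<^sup>*}} \<le> real (d * (d - 1) ^ n) * r ^ n"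
    proof (rule measure_infinite_cluster_le[OF _ _ _ v])
      show "?R \<omega> \<subseteq> E" if "\<omega> \<in> space M" for \<omega> using config_arcs_subset_E[OF that] by blast
      show "{\<omega> \<in> space M. (x, y) \<in> ?R \<omega>} \<in> sets M" for x y
        using sets.Int[OF config_arc_measurable[of V E d p x y] config_arc_measurable[of V E d p y x]]
        by (rule back_subst[of "\<lambda>A. A \<in> sets M"]) auto
      fix xs assume xs: "xs \<in> saws E v (Suc n)"
      then obtain y x ys where eq: "xs = y # x # ys" and len: "length ys = n"
        by (auto simp: saws_def length_Suc_conv)
      have "set xs \<subseteq> V" by (rule set_saws_subset[OF xs v arcs])
      \<comment> \<open>The arc from the endpoint \<open>y\<close> back to \<open>x\<close> is
        discarded, which leaves exactly the \<open>n\<close> inner vertices to be charged.\<close>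
      let ?B = "{\<omega> \<in> cylinder {} (\<lambda>_. {}). y \<in> \<omega> x \<and> successively (\<lambda>y x. y \<in> \<omega> x \<and> x \<in> \<omega> y) (x # ys)}"
      have "{\<omega> \<in> space M. successively (\<lambda>y x. (x, y) \<in> ?R \<omega>) xs} \<subseteq> ?B"
        by (auto simp: eq cylinder_def config_arcs_def elim!: successively_mono)
      moreover have "?B \<in> sets M"
        by (intro sets_cylinder_walk sets_strong_walk) (use \<open>set xs \<subseteq> V\<close> eq in auto)
      ultimately have "measure M {\<omega> \<in> space M. successively (\<lambda>y x. (x, y) \<in> ?R \<omega>) xs} \<le> measure M ?B"
        by (rule finite_measure_mono)
      also have "\<dots> \<le> measure M (cylinder {} (\<lambda>_. {})) * r ^ length ys"
        by (rule measure_strong_walk_le[OF pair r0])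
          (use xs \<open>set xs \<subseteq> V\<close> eq in \<open>auto simp: saws_def\<close>)
      finally show "measure M {\<omega> \<in> space M. successively (\<lambda>y x. (x, y) \<in> ?R \<omega>) xs} \<le> r ^ n"
        by (simp add: cylinder_sets(2) len)
    qed (use r0 in auto)
    then show ?thesis by (simp add: power_mult_distrib)
  qed
  then have "measure M {\<omega> \<in> space M. infinite {x \<in> V. (v, x) \<in> (?R \<omega>)\<^sup>*}} \<le> 0"
    by (rule nonpos_if_le_geometric) (use r0 r in auto)
  then show ?thesis
    unfolding strong_theta_def strong_cluster_def strongly_connected_def
    using measure_nonneg antisym by blast
qed

lemma weak_theta_eq_0:
  assumes v: "v \<in> V" and "1 \<le> d" and s: "0 < s" "s \<le> 1" and p01: "1 - s\<^sup>2 \<le> p 0 + p 1"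
    and r: "real (d - 1) * (1 / real d + s\<^sup>2 + s) < 1"
  shows "weak_theta V E v d p = 0"
proof -
  let ?R = "\<lambda>\<omega>. config_arcs V \<omega> \<union> (config_arcs V \<omega>)\<inverse>"
  let ?q = "1 / real d + s\<^sup>2"
  let ?l = "?q + s"
  have q0: "0 \<le> ?q" by simp
  have single: "marginal x {u} \<le> ?q" if "x \<in> V" "u \<in> nbrs E x" for x u
    using marginal_le[of x "{u}" 1] that \<open>1 \<le> d\<close> p01 by simp
  \<comment> \<open>With \<open>k = 1\<close> the main term vanishes, as \<open>1 choose 2\<close>
    is 0; only the mass of states of size at least 2 remains.\<close>
  have pair: "marginal x {u, w} \<le> s\<^sup>2" if "x \<in> V" "u \<in> nbrs E x" "w \<in> nbrs E x" "u \<noteq> w" for x u w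
    using marginal_le[of x "{u, w}" 1] that \<open>1 \<le> d\<close> p01 by simp
  have "measure M {\<omega> \<in> space M. infinite {x \<in> V. (v, x) \<in> (?R \<omega>)\<^sup>*}} \<le>
      real d * ?l / s * (real (d - 1) * ?l) ^ n" for n
  proof -
    \<comment> \<open>The weak estimate charges each of the \<open>n + 1\<close> edges, while the
      count has only \<open>n\<close> factors \<open>d - 1\<close>; the surplus factor goes into the
      constant.\<close>
    have "measure M {\<omega> \<in> space M. infinite {x \<in> V. (v, x) \<in> (?R \<omega>)\<^sup>*}} \<le>
        real (d * (d - 1) ^ n) * (?l ^ Suc n / s)"
    proof (rule measure_infinite_cluster_le[OF _ _ _ v])
      show "?R \<omega> \<subseteq> E" if "\<omega> \<in> space M" for \<omega>
        using config_arcs_subset_E[OF that] sym by (auto dest: symD)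
      show "{\<omega> \<in> space M. (x, y) \<in> ?R \<omega>} \<in> sets M" for x y
        using sets.Un[OF config_arc_measurable[of V E d p x y] config_arc_measurable[of V E d p y x]]
        by (rule back_subst[of "\<lambda>A. A \<in> sets M"]) auto
      fix xs assume xs: "xs \<in> saws E v (Suc n)"
      then obtain x ys where eq: "xs = x # ys" and len: "length ys = Suc n"
        by (auto simp: saws_def length_Suc_conv)
      have "set xs \<subseteq> V" by (rule set_saws_subset[OF xs v arcs])
      let ?B = "{\<omega> \<in> cylinder {} (\<lambda>_. {}). successively (\<lambda>y x. y \<in> \<omega> x \<or> x \<in> \<omega> y) (x # ys)}"
      have "{\<omega> \<in> space M. successively (\<lambda>y x. (x, y) \<in> ?R \<omega>) xs} \<subseteq> ?B"
        by (auto simp: eq cylinder_def config_arcs_def elim!: successively_mono)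
      moreover have "?B \<in> sets M"
        by (intro sets_cylinder_walk(1) sets_weak_walk) (use \<open>set xs \<subseteq> V\<close> eq in auto)
      ultimately have "measure M {\<omega> \<in> space M. successively (\<lambda>y x. (x, y) \<in> ?R \<omega>) xs} \<le> measure M ?B"
        by (rule finite_measure_mono)
      also have "\<dots> \<le> measure M (cylinder {} (\<lambda>_. {})) * (?l ^ length ys / s)"
        by (rule measure_weak_walk_le(1)[OF single pair q0 s])
          (use xs \<open>set xs \<subseteq> V\<close> eq in \<open>auto simp: saws_def\<close>)
      finally show "measure M {\<omega> \<in> space M. successively (\<lambda>y x. (x, y) \<in> ?R \<omega>) xs} \<le> ?l ^ Suc n / s"
        by (simp add: cylinder_sets(2) len)
    qed (use s in auto)
    also have "\<dots> = real d * ?l / s * (real (d - 1) * ?l) ^ n"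
      by (simp add: power_mult_distrib)
    finally show ?thesis .
  qed
  then have "measure M {\<omega> \<in> space M. infinite {x \<in> V. (v, x) \<in> (?R \<omega>)\<^sup>*}} \<le> 0"
    by (rule nonpos_if_le_geometric) (use s r in auto)
  then show ?thesis
    unfolding weak_theta_def weak_cluster_def weakly_connected_def
    using measure_nonneg antisym by blast
qed

end

section \<open>Choice of the thresholds\<close>

lemma real_choose_two: "real (n choose 2) = real (n * (n - 1)) / 2"
proof -
  have "even (n * (n - 1))" by auto
  then show ?thesis unfolding choose_two by (simp add: real_of_nat_div)
qed

theorem theorem5:
  fixes V :: "'v set" and E :: "('v \<times> 'v) set" and orig :: 'v and d :: nat
  assumes "infinite_simple_digraph V E orig"
    and "connected_graph V E"
    and "vertex_transitive_graph V E"
    and "regular_graph V E d"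
    and "d \<ge> 3"
  shows "(\<exists>\<epsilon>>0. \<forall>p. prob_vector d p \<and> p 0 + p 1 > 1 - \<epsilon> \<longrightarrow> weak_theta V E orig d p = 0)
    \<and> (\<forall>k::nat. k \<le> d \<and> k * (k - 1) < d \<longrightarrow>
         (\<exists>\<epsilon>>0. \<forall>p. prob_vector d p \<and> (\<Sum>i\<le>k. p i) > 1 - \<epsilon> \<longrightarrow> strong_theta V E orig d p = 0))"
proof (intro conjI allI impI)
  have orig: "orig \<in> V" using assms(1) by (simp add: infinite_simple_digraph_def)
  have perc: "percolation V E d p" if "prob_vector d p" for p
    using assms that by unfold_locales (auto simp: infinite_simple_digraph_def)
  show "\<exists>\<epsilon>>0. \<forall>p. prob_vector d p \<and> p 0 + p 1 > 1 - \<epsilon> \<longrightarrow> weak_theta V E orig d p = 0"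
  proof -
    \<comment> \<open>With this value \<open>2 * s * d = 1 / d\<close>, so the term
      \<open>- 1 / d\<close> in the expansion of \<open>(d - 1) * (1 / d + 2 * s)\<close> cancels
      and \<open>1 - 2 * s\<close> is left.\<close>
    define s where "s = 1 / (2 * (real d)\<^sup>2)"
    have d: "1 \<le> (real d)\<^sup>2" "0 < real d" using \<open>d \<ge> 3\<close> by auto
    have s: "0 < s" "s \<le> 1"
      unfolding s_def by (use d in simp, subst divide_le_eq_1_pos) (use d in linarith)+
    have "s\<^sup>2 \<le> s" using s by (simp add: power2_eq_square mult_left_le)
    then have "real (d - 1) * (1 / real d + s\<^sup>2 + s) \<le> (real d - 1) * (1 / real d + 2 * s)"
      using \<open>d \<ge> 3\<close> s by (intro mult_mono) (auto simp: of_nat_diff)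
    also have "\<dots> = 1 - 2 * s"
      using d by (simp add: s_def field_simps power2_eq_square)
    finally have r: "real (d - 1) * (1 / real d + s\<^sup>2 + s) < 1" using s by simp
    have "weak_theta V E orig d p = 0" if "prob_vector d p" "p 0 + p 1 > 1 - s\<^sup>2" for p
      by (rule percolation.weak_theta_eq_0[OF perc orig _ s _ r]) (use that \<open>d \<ge> 3\<close> in auto)
    then show ?thesis using s by (intro exI[of _ "s\<^sup>2"]) simp
  qed
  fix k :: nat assume k: "k \<le> d \<and> k * (k - 1) < d"
  show "\<exists>\<epsilon>>0. \<forall>p. prob_vector d p \<and> (\<Sum>i\<le>k. p i) > 1 - \<epsilon> \<longrightarrow> strong_theta V E orig d p = 0"
  proof -
    \<comment> \<open>The value for which \<open>d - 1\<close> times the sum of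
      \<open>(k choose 2) / (d choose 2)\<close> and \<open>e\<close> is exactly 1. It is positive
      because \<open>k * (k - 1) < d\<close>.\<close>
    define e where "e = (1 - real (k * (k - 1)) / real d) / real (d - 1)"
    have d: "0 < real d" "0 < real (d - 1)" using \<open>d \<ge> 3\<close> by auto
    have cancel: "b * (c / 2 / (a * b / 2) + (1 - c / a) / b) = 1" if "0 < a" "0 < b" for a b c :: real
      using that by (simp add: field_simps)
    have "real (k * (k - 1)) < real d" using k by (simp only: of_nat_less_iff)
    then have "0 < e" unfolding e_def using d by simp
    have "strong_theta V E orig d p = 0" if p: "prob_vector d p" "(\<Sum>i\<le>k. p i) > 1 - e" for p
    proof (rule percolation.strong_theta_eq_0[OF perc[OF p(1)] orig])
      have "real (d - 1) * (real (k choose 2) / real (d choose 2) + (1 - (\<Sum>i\<le>k. p i)))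
          < real (d - 1) * (real (k choose 2) / real (d choose 2) + e)"
        using p d by (intro mult_strict_left_mono) auto
      also have "\<dots> = 1"
        using cancel[OF d, of "real (k * (k - 1))"] unfolding real_choose_two e_def of_nat_mult .
      finally show "real (d - 1) * (real (k choose 2) / real (d choose 2) + (1 - (\<Sum>i\<le>k. p i))) < 1" .
    qed (use k in simp)
    then show ?thesis using \<open>0 < e\<close> by blast
  qed
qed

end
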